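(* Assume $\sup_{\theta\in\Theta}\int x^+\,Q_\theta(dx)<\infty$. For the reservation levels $x_{n,N}^*(\mu)$ ($0\le n\le N-1$) of the Bayesian house selling problem: a) $x_{n,N}^*(\mu)$ is increasing in $N$ for all $\mu\in\mathbb{P}(\Theta)$. b) If the utility function $U$ is DARA, then $x_{n,N}^*(\mu)$ is decreasing in $n$ for all $\mu\in\mathbb{P}(\Theta)$.
   Context: "Increasing" and "decreasing" are meant in the non-strict sense. Bayesian house selling problem. $\Theta$ is a Borel space with $\mathbb{P}(\Theta)$ its set of probability measures. Given the unknown parameter $\theta\in\Theta$, offers are i.i.d. real random variables with distribution $Q_\theta$ having density $q(x|\theta)$ (jointly measurable) with respect to a $\sigma$-finite measure $\lambda$ on $\mathbb{R}$. $c>0$ is the cost paid each time an offer is rejected, and $N\in\mathbb{N}$ is the horizon. $U:\mathbb{R}\to\mathbb{R}$ is strictly increasing and concave. Notation: $Q(\cdot|\mu)=\int_\Theta Q_\theta(\cdot)\,\mu(d\theta)$; $\Phi(x,\mu)(B)=\dfrac{\int_B q(x|\theta)\,\mu(d\theta)}{\int_\Theta q(x|\theta)\,\mu(d\theta)}$ for $B\in\mathcal{B}(\Theta)$ (a fixed arbitrary probability measure if the denominator is not in $(0,\infty)$). $V_0(x,\mu,s)=U(x+s)$, $V_n(x,\mu,s)=\max\{U(x+s),c_n(\mu,s)\}$ with $c_n(\mu,s):=\int_{\mathbb{R}}V_{n-1}(x',\Phi(x',\mu),s-c)\,Q(dx'|\mu)$, $n\ge1$; $U_n(x):=U(x-nc)$,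 so $U_n^{-1}(y)=nc+U^{-1}(y)$. The reservation levels are $$x_{n,N}^*(\mu):=U_n^{-1}\big(c_{N-n}(\mu,-nc)\big),\quad n=0,\dots,N-1.$$ Integrals of utilities take values in $[-\infty,\infty)$; conventions $U(-\infty)=-\infty$, $U^{-1}(-\infty)=-\infty$. $U$ is DARA (decreasing absolute risk aversion) if the Arrow–Pratt function $l_U(x)=-U''(x)/U'(x)$ is decreasing in $x$ (in this case $U$ is twice differentiable with positive first derivative, so that $l_U$ is defined). *)

theory Defs
  imports "HOL-Probability.Probability"
begin

text \<open>
  Integral of an extended-real function as the integral of the positive part minus the integral of
  the negative part (\<^term>\<open>e2ennreal\<close> truncates negative values to 0). For utilities the
  first term is finite, so the value lies in \<open>[-\<infinity>, \<infinity>)\<close>.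
\<close>
definition ereal_integral :: "'a measure \<Rightarrow> ('a \<Rightarrow> ereal) \<Rightarrow> ereal" where
  "ereal_integral M f =
     enn2ereal (\<integral>\<^sup>+ x. e2ennreal (f x) \<partial>M) - enn2ereal (\<integral>\<^sup>+ x. e2ennreal (- f x) \<partial>M)"

text \<open>
  In what follows, \<open>\<Theta>\<close> is a Borel subset of a Polish space, \<open>lam\<close> is the
  reference measure \<open>\<lambda>\<close> on the reals, \<open>q x \<theta>\<close> is \<open>q(x|\<theta>)\<close>,
  and \<open>\<nu>\<close> is the fixed arbitrary value of \<open>\<Phi>(x,\<mu>)\<close> used when the normalising
  constant is not in \<open>(0,\<infinity>)\<close>.
\<close>

definition priors :: "'a::polish_space set \<Rightarrow> 'a measure set" where
  "priors \<Theta> = space (prob_algebra (restrict_space borel \<Theta>))"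

definition offer_dist :: "real measure \<Rightarrow> (real \<Rightarrow> 'a \<Rightarrow> real) \<Rightarrow> 'a \<Rightarrow> real measure" where
  "offer_dist lam q \<theta> = density lam (\<lambda>x. ennreal (q x \<theta>))"

definition predictive :: "real measure \<Rightarrow> (real \<Rightarrow> 'a \<Rightarrow> real) \<Rightarrow> 'a measure \<Rightarrow> real measure" where
  "predictive lam q \<mu> = \<mu> \<bind> offer_dist lam q"

definition posterior ::
    "(real \<Rightarrow> 'a \<Rightarrow> real) \<Rightarrow> 'a measure \<Rightarrow> real \<Rightarrow> 'a measure \<Rightarrow> 'a measure" where
  "posterior q \<nu> x \<mu> =
     (let Z = (\<integral>\<^sup>+ \<theta>. ennreal (q x \<theta>) \<partial>\<mu>)
      in if 0 < Z \<and> Z < \<infinity> then density \<mu> (\<lambda>\<theta>. ennreal (q x \<theta>) / Z) else \<nu>)"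

text \<open>
  Value of rejecting the current offer when \<open>W x \<mu> s\<close> is the value at the next stage.
\<close>
definition reject_value ::
    "real measure \<Rightarrow> (real \<Rightarrow> 'a \<Rightarrow> real) \<Rightarrow> real \<Rightarrow> 'a measure \<Rightarrow>
     (real \<Rightarrow> 'a measure \<Rightarrow> real \<Rightarrow> ereal) \<Rightarrow> 'a measure \<Rightarrow> real \<Rightarrow> ereal" where
  "reject_value lam q c \<nu> W \<mu> s =
     ereal_integral (predictive lam q \<mu>) (\<lambda>x'. W x' (posterior q \<nu> x' \<mu>) (s - c))"

primrec value_fun ::
    "real measure \<Rightarrow> (real \<Rightarrow> 'a \<Rightarrow> real) \<Rightarrow> real \<Rightarrow> (real \<Rightarrow> real) \<Rightarrow> 'a measure \<Rightarrow>
     nat \<Rightarrow> real \<Rightarrow> 'a measure \<Rightarrow> real \<Rightarrow> ereal" where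
  "value_fun lam q c U \<nu> 0 = (\<lambda>x \<mu> s. ereal (U (x + s)))"
| "value_fun lam q c U \<nu> (Suc n) =
     (\<lambda>x \<mu> s. max (ereal (U (x + s))) (reject_value lam q c \<nu> (value_fun lam q c U \<nu> n) \<mu> s))"

text \<open>The function \<open>c\<^sub>n(\<mu>,s)\<close>; only meaningful for \<open>n \<ge> 1\<close>.\<close>
definition continuation_value ::
    "real measure \<Rightarrow> (real \<Rightarrow> 'a \<Rightarrow> real) \<Rightarrow> real \<Rightarrow> (real \<Rightarrow> real) \<Rightarrow> 'a measure \<Rightarrow>
     nat \<Rightarrow> 'a measure \<Rightarrow> real \<Rightarrow> ereal" where
  "continuation_value lam q c U \<nu> n \<mu> s =
     reject_value lam q c \<nu> (value_fun lam q c U \<nu> (n - 1)) \<mu> s"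

text \<open>
  Inverse of a real function, extended by \<open>-\<infinity> \<mapsto> -\<infinity>\<close>. The continuation values
  are either \<open>-\<infinity>\<close> or in the range of the utility function, so the
  value at \<open>\<infinity>\<close> and the values of \<^term>\<open>inv f\<close> off the range of \<open>f\<close> are irrelevant.
\<close>
definition ext_inv :: "(real \<Rightarrow> real) \<Rightarrow> ereal \<Rightarrow> ereal" where
  "ext_inv f y = (case y of ereal r \<Rightarrow> ereal (inv f r) | PInfty \<Rightarrow> \<infinity> | MInfty \<Rightarrow> -\<infinity>)"

definition shifted_utility :: "real \<Rightarrow> (real \<Rightarrow> real) \<Rightarrow> nat \<Rightarrow> real \<Rightarrow> real" where
  "shifted_utility c U n x = U (x - real n * c)"

definition reservation_level ::
    "real measure \<Rightarrow> (real \<Rightarrow> 'a \<Rightarrow> real) \<Rightarrow> real \<Rightarrow> (real \<Rightarrow> real) \<Rightarrow> 'a measure \<Rightarrow>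
     nat \<Rightarrow> nat \<Rightarrow> 'a measure \<Rightarrow> ereal" where
  "reservation_level lam q c U \<nu> n N \<mu> =
     ext_inv (shifted_utility c U n)
       (continuation_value lam q c U \<nu> (N - n) \<mu> (- (real n * c)))"

definition arrow_pratt :: "(real \<Rightarrow> real) \<Rightarrow> real \<Rightarrow> real" where
  "arrow_pratt U x = - deriv (deriv U) x / deriv U x"

definition DARA :: "(real \<Rightarrow> real) \<Rightarrow> bool" where
  "DARA U \<longleftrightarrow>
     (\<forall>x. U differentiable (at x)) \<and> (\<forall>x. deriv U differentiable (at x)) \<and>
     (\<forall>x. deriv U x > 0) \<and> antimono (arrow_pratt U)"

end

theory Submission
  imports Defs
begin

text \<open>
  Everything is read off from one equivalence: the reservation level \<open>x\<^sub>n\<^sub>,\<^sub>N(\<mu>)\<close> is at most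
  \<open>t\<close> iff rejecting, seen from the wealth \<open>s = -nc\<close> reached after \<open>n\<close> rejections and with
  \<open>N - n\<close> stages to go, is worth at most \<open>U(s + t)\<close>
  (\<open>reservation_level_le_iff\<close>). So the reservation level is the certainty equivalent of
  rejection relative to current wealth, and two such levels are compared by comparing the bounds
  \<open>t\<close> that they satisfy. The equivalence requires the value of
  rejection to be \<open>-\<infinity>\<close> or a value of \<open>U\<close>. As \<open>U\<close> is continuous and tends to
  \<open>-\<infinity>\<close> at \<open>-\<infinity>\<close>, it suffices to stay below some \<open>U(z)\<close>. If \<open>m\<close> bounds the
  means of the positive parts of the offers, then Jensen's inequality and induction give
  \<open>V\<^sub>n(x,\<mu>,s) \<le> U(max x 0 + s + nm)\<close> (\<open>value_fun_le\<close>).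

  Part a) holds because a longer horizon only adds options: \<open>V\<^sub>n\<close> increases with \<open>n\<close>, hence so
  does the value of rejection (\<open>rejection_mono\<close>).

  For part b), passing from \<open>n\<close> to a later time \<open>n'\<close> changes two things. Fewer stages remain, which
  lowers the level as in a); and wealth is lower, since more rejections have been paid for. The
  effect of wealth is Pratt's: under DARA, for \<open>s \<le> s'\<close> the utility \<open>U(s + \<cdot>)\<close> is an increasing
  concave function of \<open>U(s' + \<cdot>)\<close>, so the poorer agent has the smaller certainty equivalent
  relative to wealth. Only the tangent inequality of that concave function is used
  (\<open>DARA_wealth_comparison\<close>); integrating it propagates the comparison through the recursion for
  the value functions (\<open>rejection_certainty_equivalent_step\<close>). This integration is where additivity
  of the integral, and therefore measurability of \<open>x \<mapsto> V\<^sub>n(x, \<Phi>(x,\<mu>), s)\<close>, enters; it comes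
  from measurability of the Bayes operator between spaces of measures
  (\<open>posterior_measurable\<close>).
\<close>

section \<open>Integrals of extended-real functions\<close>

lemma e2ennreal_ereal: "e2ennreal (ereal r) = ennreal r"
  by (simp add: ennreal.abs_eq)

text \<open>
  Monotonicity holds for arbitrary integrands, because the integral of a non-negative function is a
  supremum over the simple functions below it. Bounds on value functions therefore pass to
  continuation values directly.
\<close>
lemma ereal_integral_mono:
  assumes "\<And>x. x \<in> space M \<Longrightarrow> f x \<le> g x"
  shows "ereal_integral M f \<le> ereal_integral M g"
  unfolding ereal_integral_def
proof (rule ereal_minus_mono)
  show "enn2ereal (\<integral>\<^sup>+ x. e2ennreal (f x) \<partial>M) \<le> enn2ereal (\<integral>\<^sup>+ x. e2ennreal (g x) \<partial>M)"
    using assms by (auto simp flip: less_eq_ennreal.rep_eq intro!: nn_integral_mono e2ennreal_mono)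
  show "enn2ereal (\<integral>\<^sup>+ x. e2ennreal (- g x) \<partial>M) \<le> enn2ereal (\<integral>\<^sup>+ x. e2ennreal (- f x) \<partial>M)"
    using assms by (auto simp flip: less_eq_ennreal.rep_eq intro!: nn_integral_mono e2ennreal_mono)
qed

lemma ereal_integral_eq_integral:
  assumes "integrable M f"
  shows "ereal_integral M (\<lambda>x. ereal (f x)) = ereal (\<integral>x. f x \<partial>M)"
proof -
  have fin: "(\<integral>\<^sup>+ x. ennreal (f x) \<partial>M) \<noteq> \<infinity>" "(\<integral>\<^sup>+ x. ennreal (- f x) \<partial>M) \<noteq> \<infinity>"
    using assms by (auto simp: real_integrable_def)
  have "enn2ereal y = ereal (enn2real y)" if "y \<noteq> \<infinity>" for y
    using that by (cases y) (auto simp: enn2ereal_ennreal)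
  with fin show ?thesis
    by (simp add: ereal_integral_def e2ennreal_ereal real_lebesgue_integral_def[OF assms])
qed

lemma ereal_integral_eq_MInfty:
  assumes "f \<in> borel_measurable M" "(\<integral>\<^sup>+ x. ennreal (f x) \<partial>M) \<noteq> \<infinity>" "\<not> integrable M f"
  shows "ereal_integral M (\<lambda>x. ereal (f x)) = -\<infinity>"
proof -
  have "(\<integral>\<^sup>+ x. ennreal (- f x) \<partial>M) = \<infinity>"
    using assms by (auto simp: real_integrable_def)
  moreover have "enn2ereal y - \<infinity> = -\<infinity>" if "y \<noteq> \<infinity>" for y
    using that by (cases y) (auto simp: enn2ereal_ennreal)
  ultimately show ?thesis
    using assms(2) by (simp add: ereal_integral_def e2ennreal_ereal)
qed

text \<open>
  A measurable integrand whose integral is not \<open>\<infinity>\<close> has an integrable positive part; so it is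
  either integrable, where this is linearity, or both sides are \<open>-\<infinity>\<close>.
\<close>
lemma (in prob_space) ereal_integral_affine:
  assumes f [measurable]: "f \<in> borel_measurable M" and b: "b > 0"
    and fin: "ereal_integral M (\<lambda>x. ereal (f x)) \<noteq> \<infinity>"
  shows "ereal_integral M (\<lambda>x. ereal (a + b * f x))
       = ereal a + ereal b * ereal_integral M (\<lambda>x. ereal (f x))"
proof (cases "integrable M f")
  case True
  then show ?thesis
    by (simp add: ereal_integral_eq_integral prob_space)
next
  case False
  have pos: "(\<integral>\<^sup>+ x. ennreal (f x) \<partial>M) \<noteq> \<infinity>"
    using fin by (auto simp: ereal_integral_def e2ennreal_ereal)
  have "(\<integral>\<^sup>+ x. ennreal (a + b * f x) \<partial>M) \<le> (\<integral>\<^sup>+ x. ennreal \<bar>a\<bar> + ennreal b * ennreal (f x) \<partial>M)"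
  proof (rule nn_integral_mono)
    fix x
    have "ennreal (a + b * f x) \<le> ennreal (\<bar>a\<bar> + b * max 0 (f x))"
      using b by (intro ennreal_leI add_mono mult_left_mono) auto
    also have "\<dots> = ennreal \<bar>a\<bar> + ennreal b * ennreal (f x)"
      using b by (simp add: ennreal_mult ennreal_max_0)
    finally show "ennreal (a + b * f x) \<le> ennreal \<bar>a\<bar> + ennreal b * ennreal (f x)" .
  qed
  also have "\<dots> = ennreal \<bar>a\<bar> + ennreal b * (\<integral>\<^sup>+ x. ennreal (f x) \<partial>M)"
    by (simp add: nn_integral_add nn_integral_cmult emeasure_space_1)
  also have "\<dots> < \<infinity>"
    using pos by (simp add: ennreal_mult_less_top less_top)
  finally have pos': "(\<integral>\<^sup>+ x. ennreal (a + b * f x) \<partial>M) \<noteq> \<infinity>" by simp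
  have "\<not> integrable M (\<lambda>x. a + b * f x)"
  proof
    assume "integrable M (\<lambda>x. a + b * f x)"
    then have "integrable M (\<lambda>x. ((a + b * f x) - a) / b)"
      by (intro integrable_divide Bochner_Integration.integrable_diff) auto
    with b False show False by simp
  qed
  with False pos pos' b show ?thesis
    by (simp add: ereal_integral_eq_MInfty)
qed

section \<open>Increasing concave utilities\<close>

lemma concave_strict_mono_supporting_line:
  fixes U :: "real \<Rightarrow> real"
  assumes "concave_on UNIV U" "strict_mono U"
  obtains b where "b > 0" "\<And>y. U y \<le> U z + b * (y - z)"
proof -
  define b where "b = - Inf ((\<lambda>t. (- U z - - U t) / (z - t)) ` ({z<..} \<inter> UNIV))"
  have line: "U y \<le> U z + b * (y - z)" for y
    using convex_le_Inf_differential[of UNIV "\<lambda>x. - U x" z y] assms(1)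
    by (simp add: concave_on_def b_def)
  have "b > 0"
    using line[of "z + 1"] strict_monoD[OF assms(2), of z "z + 1"] by simp
  with line show thesis by (rule that[rotated])
qed

text \<open>
  A supporting line of positive slope forces the utility below every bound far to the left, and the
  intermediate value theorem does the rest.
\<close>
lemma concave_strict_mono_attains_smaller:
  fixes U :: "real \<Rightarrow> real"
  assumes "concave_on UNIV U" "strict_mono U" "r \<le> U z"
  shows "r \<in> range U"
proof -
  obtain b where b: "b > 0" "\<And>y. U y \<le> U z + b * (y - z)"
    using concave_strict_mono_supporting_line[OF assms(1,2)] by blast
  define w where "w = z - (U z - r) / b"
  have "U w \<le> r" "w \<le> z"
    using b(2)[of w] b(1) assms(3) by (auto simp: w_def field_simps)
  moreover have "continuous_on UNIV (\<lambda>x. - U x)"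
    using convex_on_continuous[of UNIV "\<lambda>x. - U x"] assms(1) by (simp add: concave_on_def)
  from continuous_on_minus[OF this] have "continuous_on UNIV U" by simp
  then have "continuous_on {w..z} U"
    by (auto intro: continuous_on_subset)
  ultimately show ?thesis
    using IVT'[of U w r z] assms(3) by auto
qed

text \<open>
  Jensen's inequality combined with monotonicity, obtained by integrating the supporting line at
  \<open>m + t\<close>.
\<close>
lemma (in prob_space) ereal_integral_concave_shift_le:
  assumes U: "concave_on UNIV U" "strict_mono U"
    and f [measurable]: "f \<in> borel_measurable M" and f0: "\<And>x. 0 \<le> f x"
    and m: "0 \<le> m" "(\<integral>\<^sup>+ x. ennreal (f x) \<partial>M) \<le> ennreal m"
  shows "ereal_integral M (\<lambda>x. ereal (U (f x + t))) \<le> ereal (U (m + t))"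
proof -
  obtain b where b: "b > 0" "\<And>y. U y \<le> U (m + t) + b * (y - (m + t))"
    using concave_strict_mono_supporting_line[OF U] by blast
  have int: "integrable M f"
    using m(2) f0 by (intro integrableI_nonneg) (auto simp: order_le_less_trans)
  have "ennreal (\<integral>x. f x \<partial>M) \<le> ennreal m"
    using nn_integral_eq_integral[OF int] f0 m(2) by simp
  then have Ef: "(\<integral>x. f x \<partial>M) \<le> m" using m(1) by (simp add: ennreal_le_iff)
  have "ereal_integral M (\<lambda>x. ereal (U (f x + t)))
     \<le> ereal_integral M (\<lambda>x. ereal (U (m + t) + b * (f x - m)))"
  proof (rule ereal_integral_mono)
    fix x show "ereal (U (f x + t)) \<le> ereal (U (m + t) + b * (f x - m))"
      using b(2)[of "f x + t"] by simp
  qed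
  also have "\<dots> = ereal (U (m + t) + b * ((\<integral>x. f x \<partial>M) - m))"
    using int by (subst ereal_integral_eq_integral) (auto simp: prob_space)
  also have "\<dots> \<le> ereal (U (m + t))"
    using Ef b(1) by (simp add: mult_le_0_iff)
  finally show ?thesis .
qed

section \<open>Decreasing absolute risk aversion and wealth\<close>

lemma DARA_DERIV:
  assumes "DARA U"
  shows "(U has_real_derivative deriv U x) (at x)"
    "(deriv U has_real_derivative deriv (deriv U) x) (at x)"
  using assms unfolding DARA_def by (simp_all add: DERIV_deriv_iff_real_differentiable)

text \<open>
  The logarithm of the ratio has derivative \<open>l\<^sub>U(s' + z) - l\<^sub>U(s + z)\<close>, which is non-positive
  when the absolute risk aversion \<open>l\<^sub>U\<close> decreases.
\<close>
lemma DARA_marginal_ratio_antimono: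
  assumes D: "DARA U" and s: "s \<le> s'" and xy: "x \<le> y"
  shows "deriv U (s + y) / deriv U (s' + y) \<le> deriv U (s + x) / deriv U (s' + x)"
proof -
  have pos: "deriv U z > 0" for z using D by (simp add: DARA_def)
  define L where "L z = ln (deriv U (s + z)) - ln (deriv U (s' + z))" for z
  have "L y \<le> L x"
  proof (rule DERIV_nonpos_imp_nonincreasing[OF xy])
    fix z
    have "(L has_real_derivative arrow_pratt U (s' + z) - arrow_pratt U (s + z)) (at z)"
      unfolding L_def arrow_pratt_def using pos
      by (auto intro!: derivative_eq_intros DERIV_chain2[OF DARA_DERIV(2)[OF D]] simp: field_simps)
    moreover have "arrow_pratt U (s' + z) \<le> arrow_pratt U (s + z)"
      using D s by (auto simp: DARA_def antimono_def)
    ultimately show "\<exists>d. (L has_real_derivative d) (at z) \<and> d \<le> 0" by auto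
  qed
  moreover have "L z = ln (deriv U (s + z) / deriv U (s' + z))" for z
    using pos[of "s + z"] pos[of "s' + z"] by (simp add: L_def ln_div)
  moreover have "0 < deriv U (s + z) / deriv U (s' + z)" for z
    using pos by simp
  ultimately show ?thesis by (metis ln_le_cancel_iff)
qed

text \<open>
  The tangent inequality at \<open>z\<close> for \<open>U(s + \<cdot>)\<close> regarded as a concave function of \<open>U(s' + \<cdot>)\<close>.
  With \<open>b\<close> the slope, the derivative of \<open>U(s + \<cdot>) - b U(s' + \<cdot>)\<close> is non-negative to the left
  of \<open>z\<close> and non-positive to its right, because the ratio of marginal utilities decreases and equals \<open>b\<close> there.
\<close>
lemma DARA_wealth_comparison:
  assumes D: "DARA U" and s: "s \<le> s'"
  shows "U (s + y) \<le> U (s + z) + deriv U (s + z) / deriv U (s' + z) * (U (s' + y) - U (s' + z))"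
proof -
  have pos: "deriv U x > 0" for x using D by (simp add: DARA_def)
  define b where "b = deriv U (s + z) / deriv U (s' + z)"
  define F where "F x = U (s + x) - b * U (s' + x)" for x
  define F' where "F' x = deriv U (s' + x) * (deriv U (s + x) / deriv U (s' + x) - b)" for x
  have DF: "(F has_real_derivative F' x) (at x)" for x
  proof -
    have "F' x = deriv U (s + x) - b * deriv U (s' + x)"
      using pos[of "s' + x"] by (simp add: F'_def field_simps)
    then show ?thesis
      unfolding F_def by (auto intro!: derivative_eq_intros DERIV_chain2[OF DARA_DERIV(1)[OF D]])
  qed
  have "F y \<le> F z"
  proof (cases "y \<le> z")
    case True
    have "0 \<le> F' x" if "x \<le> z" for x
      unfolding F'_def b_def using DARA_marginal_ratio_antimono[OF D s that] pos[of "s' + x"] by simp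
    with DF show ?thesis by (intro DERIV_nonneg_imp_nondecreasing[OF True]) auto
  next
    case False
    have "F' x \<le> 0" if "z \<le> x" for x
      unfolding F'_def b_def using DARA_marginal_ratio_antimono[OF D s that] pos[of "s' + x"]
      by (simp add: mult_le_0_iff)
    with DF False show ?thesis by (intro DERIV_nonpos_imp_nonincreasing[of z y]) auto
  qed
  then show ?thesis
    unfolding b_def[symmetric] by (simp add: F_def right_diff_distrib)
qed

section \<open>Measurability of beliefs and value functions\<close>

locale bayesian_house_selling =
  fixes \<Theta> :: "'a::polish_space set"
    and lam :: "real measure"
    and q :: "real \<Rightarrow> 'a \<Rightarrow> real"
    and c :: real
    and U :: "real \<Rightarrow> real"
    and \<nu> :: "'a measure"
  assumes nu: "\<nu> \<in> priors \<Theta>"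
    and lam: "sigma_finite_measure lam" "sets lam = sets borel"
    and q_measurable: "(\<lambda>(x, \<theta>). q x \<theta>) \<in> borel_measurable (borel \<Otimes>\<^sub>M restrict_space borel \<Theta>)"
    and offer_prob: "\<And>\<theta>. \<theta> \<in> \<Theta> \<Longrightarrow> prob_space (offer_dist lam q \<theta>)"
    and c_pos: "c > 0"
    and U: "strict_mono U" "concave_on UNIV U"
    and offer_bound: "(SUP \<theta>\<in>\<Theta>. \<integral>\<^sup>+ x. ennreal (max x 0) \<partial>offer_dist lam q \<theta>) < \<infinity>"
begin

abbreviation "param \<equiv> restrict_space borel \<Theta>"
abbreviation "V \<equiv> value_fun lam q c U \<nu>"
text \<open>
  The index counts the stages after the next offer, so \<open>rejection n\<close> is \<open>c\<^bsub>n+1\<^esub>\<close>.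
\<close>
abbreviation "rejection n \<equiv> reject_value lam q c \<nu> (V n)"

lemma q_measurable_pair [measurable (raw)]:
  assumes "f \<in> M \<rightarrow>\<^sub>M borel" "g \<in> M \<rightarrow>\<^sub>M param"
  shows "(\<lambda>x. q (f x) (g x)) \<in> borel_measurable M"
  using measurable_compose[OF measurable_Pair[OF assms] q_measurable] by simp

lemma space_param: "space param = \<Theta>"
  by (simp add: space_restrict_space)

lemma space_lam [simp]: "space lam = UNIV"
  using sets_eq_imp_space_eq[OF lam(2)] by simp

lemma priors_iff: "\<mu> \<in> priors \<Theta> \<longleftrightarrow> sets \<mu> = sets param \<and> prob_space \<mu>"
  by (auto simp: priors_def space_prob_algebra)

lemma offer_dist_measurable [measurable]: "offer_dist lam q \<in> param \<rightarrow>\<^sub>M prob_algebra borel"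
proof (rule measurable_prob_algebraI)
  show "offer_dist lam q \<in> param \<rightarrow>\<^sub>M subprob_algebra borel"
  proof (rule measurable_subprob_algebra)
    fix A :: "real set" assume A [measurable]: "A \<in> sets borel"
    interpret sigma_finite_measure lam by (rule lam)
    have A' [measurable]: "A \<in> sets lam" using lam(2) A by simp
    have id [measurable]: "(\<lambda>x. x) \<in> lam \<rightarrow>\<^sub>M borel" by (simp add: measurable_ident_sets lam(2))
    have "(\<lambda>\<theta>. \<integral>\<^sup>+ x. ennreal (q x \<theta>) * indicator A x \<partial>lam) \<in> borel_measurable param"
      by measurable
    moreover have "emeasure (offer_dist lam q \<theta>) A = (\<integral>\<^sup>+ x. ennreal (q x \<theta>) * indicator A x \<partial>lam)"
      if "\<theta> \<in> space param" for \<theta>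
      unfolding offer_dist_def using that by (intro emeasure_density) measurable
    ultimately show "(\<lambda>\<theta>. emeasure (offer_dist lam q \<theta>) A) \<in> borel_measurable param"
      by (simp cong: measurable_cong)
  qed (auto simp: offer_dist_def lam(2) space_param
         intro!: prob_space_imp_subprob_space offer_prob[unfolded offer_dist_def])
qed (simp add: space_param offer_prob)

text \<open>
  \<open>priors \<Theta>\<close> is the space of the measurable space \<open>prob_algebra param\<close>, so the measurability
  of maps between beliefs is expressed in the Giry monad.
\<close>
lemma predictive_measurable [measurable]:
  "predictive lam q \<in> prob_algebra param \<rightarrow>\<^sub>M prob_algebra borel"
  unfolding predictive_def by (rule measurable_bind_prob_space) measurable

lemma predictive:
  assumes "\<mu> \<in> priors \<Theta>"
  shows "prob_space (predictive lam q \<mu>)" "sets (predictive lam q \<mu>) = sets borel"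
  using measurable_space[OF predictive_measurable assms[unfolded priors_def]]
  by (auto simp: space_prob_algebra)

lemma normaliser_measurable [measurable]:
  "(\<lambda>p. \<integral>\<^sup>+ \<theta>. ennreal (q (fst p) \<theta>) \<partial>snd p) \<in> borel_measurable (borel \<Otimes>\<^sub>M prob_algebra param)"
proof (rule nn_integral_measurable_subprob_algebra2[where N = param])
  show "(\<lambda>(p, \<theta>). ennreal (q (fst p) \<theta>))
      \<in> borel_measurable ((borel \<Otimes>\<^sub>M prob_algebra param) \<Otimes>\<^sub>M param)"
    unfolding split_beta' by measurable
qed (rule measurable_prob_algebraD[OF measurable_snd])

lemma posterior_in_priors:
  assumes mu: "\<mu> \<in> priors \<Theta>"
  shows "posterior q \<nu> x \<mu> \<in> priors \<Theta>"
proof -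
  define Z where "Z = (\<integral>\<^sup>+ \<theta>. ennreal (q x \<theta>) \<partial>\<mu>)"
  show ?thesis
  proof (cases "0 < Z \<and> Z < \<infinity>")
    case True
    have id: "(\<lambda>\<theta>. \<theta>) \<in> \<mu> \<rightarrow>\<^sub>M param"
      using mu by (simp add: priors_iff measurable_ident_sets)
    have [measurable]: "(\<lambda>\<theta>. q x \<theta>) \<in> borel_measurable \<mu>"
      using id by measurable
    have "prob_space (density \<mu> (\<lambda>\<theta>. ennreal (q x \<theta>) / Z))"
    proof
      have "emeasure (density \<mu> (\<lambda>\<theta>. ennreal (q x \<theta>) / Z)) (space \<mu>) = (\<integral>\<^sup>+ \<theta>. ennreal (q x \<theta>) / Z \<partial>\<mu>)"
        by (subst emeasure_density) (auto intro!: nn_integral_cong)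
      also have "\<dots> = Z / Z"
        by (simp add: nn_integral_divide Z_def)
      also have "\<dots> = 1" using True by (intro ennreal_divide_self) auto
      finally show "emeasure (density \<mu> (\<lambda>\<theta>. ennreal (q x \<theta>) / Z))
          (space (density \<mu> (\<lambda>\<theta>. ennreal (q x \<theta>) / Z))) = 1" by simp
    qed
    with True mu show ?thesis
      by (simp add: posterior_def Z_def[symmetric] Let_def priors_iff)
  next
    case False
    then show ?thesis using nu by (auto simp: posterior_def Z_def[symmetric] Let_def)
  qed
qed

text \<open>
  Measurability into a space of measures is tested on each event \<open>A\<close>. The posterior probability
  of \<open>A\<close> is an integral against the prior, jointly measurable in the offer and the prior; the
  fallback value \<open>\<nu>\<close> is taken on the measurable set where the normalising constant is degenerate.
\<close>
lemma posterior_measurable: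
  "(\<lambda>(x, \<mu>). posterior q \<nu> x \<mu>) \<in> borel \<Otimes>\<^sub>M prob_algebra param \<rightarrow>\<^sub>M prob_algebra param"
proof (rule measurable_prob_algebraI)
  let ?P = "borel \<Otimes>\<^sub>M prob_algebra param"
  have in_priors: "(case p of (x, \<mu>) \<Rightarrow> posterior q \<nu> x \<mu>) \<in> priors \<Theta>" if "p \<in> space ?P" for p
    using that posterior_in_priors by (auto simp: space_pair_measure priors_def)
  then show "prob_space (case p of (x, \<mu>) \<Rightarrow> posterior q \<nu> x \<mu>)" if "p \<in> space ?P" for p
    using that by (simp add: priors_iff)
  show "(\<lambda>(x, \<mu>). posterior q \<nu> x \<mu>) \<in> ?P \<rightarrow>\<^sub>M subprob_algebra param"
  proof (rule measurable_subprob_algebra)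
    fix A assume A [measurable]: "A \<in> sets param"
    define Z where "Z p = (\<integral>\<^sup>+ \<theta>. ennreal (q (fst p) \<theta>) \<partial>snd p)" for p
    have Z [measurable]: "Z \<in> borel_measurable ?P" unfolding Z_def by measurable
    have I: "(\<lambda>p. \<integral>\<^sup>+ \<theta>. ennreal (q (fst p) \<theta>) / Z p * indicator A \<theta> \<partial>snd p) \<in> borel_measurable ?P"
    proof (rule nn_integral_measurable_subprob_algebra2[where N = param])
      show "(\<lambda>(p, \<theta>). ennreal (q (fst p) \<theta>) / Z p * indicator A \<theta>)
          \<in> borel_measurable (?P \<Otimes>\<^sub>M param)"
        unfolding split_beta' by measurable
    qed (rule measurable_prob_algebraD[OF measurable_snd])
    have "emeasure (case p of (x, \<mu>) \<Rightarrow> posterior q \<nu> x \<mu>) A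
        = (if 0 < Z p \<and> Z p < \<infinity> then \<integral>\<^sup>+ \<theta>. ennreal (q (fst p) \<theta>) / Z p * indicator A \<theta> \<partial>snd p
           else emeasure \<nu> A)" if p: "p \<in> space ?P" for p
    proof -
      obtain x \<mu> where [simp]: "p = (x, \<mu>)" by (cases p)
      have mu: "sets \<mu> = sets param" using p by (auto simp: space_pair_measure space_prob_algebra)
      then have id: "(\<lambda>\<theta>. \<theta>) \<in> \<mu> \<rightarrow>\<^sub>M param" by (simp add: measurable_ident_sets)
      have "(\<lambda>\<theta>. q x \<theta>) \<in> borel_measurable \<mu>" using id by measurable
      then show ?thesis
        using mu A by (simp add: posterior_def Z_def Let_def emeasure_density)
    qed
    then show "(\<lambda>p. emeasure (case p of (x, \<mu>) \<Rightarrow> posterior q \<nu> x \<mu>) A) \<in> borel_measurable ?P"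
      using I by (simp cong: measurable_cong)
  qed (use in_priors in \<open>auto simp: priors_iff prob_space_imp_subprob_space\<close>)
qed

lemma U_measurable [measurable]: "U \<in> borel_measurable borel"
  using U(1) by (intro borel_measurable_mono strict_mono_mono)

lemma value_fun_measurable:
  "(\<lambda>(x, \<mu>). V n x \<mu> s) \<in> borel_measurable (borel \<Otimes>\<^sub>M prob_algebra param)"
proof (induction n arbitrary: s)
  case 0
  then show ?case by simp
next
  case (Suc n)
  note V_meas [measurable] = Suc[of "s - c"]
  have "(\<lambda>(\<mu>, x). (x, posterior q \<nu> x \<mu>))
      \<in> prob_algebra param \<Otimes>\<^sub>M borel \<rightarrow>\<^sub>M borel \<Otimes>\<^sub>M prob_algebra param"
    using measurable_compose[OF measurable_pair_swap' posterior_measurable]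
    by (auto simp: split_beta' intro!: measurable_Pair)
  from measurable_compose[OF this V_meas]
  have [measurable]: "(\<lambda>(\<mu>, x). V n x (posterior q \<nu> x \<mu>) (s - c))
      \<in> borel_measurable (prob_algebra param \<Otimes>\<^sub>M borel)"
    by (simp add: split_beta')
  have "(\<lambda>\<mu>. rejection n \<mu> s) \<in> borel_measurable (prob_algebra param)"
    unfolding reject_value_def ereal_integral_def
    by (intro borel_measurable_ereal_diff measurable_compose[OF _ measurable_enn2ereal]
          nn_integral_measurable_subprob_algebra2[where N = borel]
          measurable_prob_algebraD predictive_measurable) measurable
  then show ?case by simp
qed

lemma value_after_offer_measurable:
  assumes mu: "\<mu> \<in> priors \<Theta>"
  shows "(\<lambda>x. V n x (posterior q \<nu> x \<mu>) s) \<in> borel_measurable borel"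
proof -
  have mu': "\<mu> \<in> space (prob_algebra param)" using mu by (simp add: priors_def)
  have "(\<lambda>x. posterior q \<nu> x \<mu>) \<in> borel \<rightarrow>\<^sub>M prob_algebra param"
    using measurable_compose[OF measurable_Pair2'[OF mu'] posterior_measurable] by simp
  then have "(\<lambda>x. (x, posterior q \<nu> x \<mu>)) \<in> borel \<rightarrow>\<^sub>M borel \<Otimes>\<^sub>M prob_algebra param"
    by measurable
  from measurable_compose[OF this value_fun_measurable] show ?thesis by simp
qed

section \<open>Continuation values stay in the range of the utility\<close>

definition mean_bound :: real where
  "mean_bound = enn2real (SUP \<theta>\<in>\<Theta>. \<integral>\<^sup>+ x. ennreal (max x 0) \<partial>offer_dist lam q \<theta>)"

lemma mean_bound_nonneg: "0 \<le> mean_bound"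
  by (simp add: mean_bound_def)

lemma predictive_mean_le:
  assumes mu: "\<mu> \<in> priors \<Theta>"
  shows "(\<integral>\<^sup>+ x. ennreal (max x 0) \<partial>predictive lam q \<mu>) \<le> ennreal mean_bound"
proof -
  interpret prob_space \<mu> using mu by (simp add: priors_iff)
  have meas: "offer_dist lam q \<in> \<mu> \<rightarrow>\<^sub>M subprob_algebra borel"
    using mu measurable_prob_algebraD[OF offer_dist_measurable]
    by (simp add: priors_iff cong: measurable_cong_sets)
  have sp: "space \<mu> = \<Theta>"
    using mu sets_eq_imp_space_eq[of \<mu> param] by (simp add: priors_iff space_param)
  have "(\<integral>\<^sup>+ x. ennreal (max x 0) \<partial>predictive lam q \<mu>)
      = (\<integral>\<^sup>+ \<theta>. \<integral>\<^sup>+ x. ennreal (max x 0) \<partial>offer_dist lam q \<theta> \<partial>\<mu>)"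
    unfolding predictive_def by (rule nn_integral_bind[OF _ meas]) measurable
  also have "\<dots> \<le> (\<integral>\<^sup>+ \<theta>. (SUP \<theta>\<in>\<Theta>. \<integral>\<^sup>+ x. ennreal (max x 0) \<partial>offer_dist lam q \<theta>) \<partial>\<mu>)"
    by (intro nn_integral_mono) (auto simp: sp intro: SUP_upper)
  also have "\<dots> = ennreal mean_bound"
    using offer_bound by (simp add: emeasure_space_1 mean_bound_def)
  finally show ?thesis .
qed

lemma rejection_le_of_value_le:
  assumes mu: "\<mu> \<in> priors \<Theta>"
    and le: "\<And>x \<mu>'. \<mu>' \<in> priors \<Theta> \<Longrightarrow> V n x \<mu>' (s - c) \<le> ereal (U (max x 0 + t))"
  shows "rejection n \<mu> s \<le> ereal (U (mean_bound + t))"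
proof -
  interpret prob_space "predictive lam q \<mu>" by (rule predictive[OF mu])
  have "rejection n \<mu> s \<le> ereal_integral (predictive lam q \<mu>) (\<lambda>x. ereal (U (max x 0 + t)))"
    unfolding reject_value_def by (intro ereal_integral_mono le posterior_in_priors mu)
  also have "\<dots> \<le> ereal (U (mean_bound + t))"
    using predictive(2)[OF mu]
    by (intro ereal_integral_concave_shift_le U mean_bound_nonneg predictive_mean_le mu)
       (auto cong: measurable_cong_sets)
  finally show ?thesis .
qed

text \<open>
  The constant \<open>mean_bound\<close> is added once per stage because Jensen's inequality replaces the
  positive part of the next offer by a bound for its mean. The bound is uniform in the prior and is
  hence preserved when the prior is updated.
\<close>
lemma value_fun_le:
  assumes "\<mu> \<in> priors \<Theta>"
  shows "V n x \<mu> s \<le> ereal (U (max x 0 + (s + real n * mean_bound)))"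
  using assms
proof (induction n arbitrary: x \<mu> s)
  case 0
  then show ?case using strict_mono_less_eq[OF U(1)] by simp
next
  case (Suc n)
  have "U (x + s) \<le> U (max x 0 + (s + real (Suc n) * mean_bound))"
    using strict_mono_less_eq[OF U(1)] mean_bound_nonneg by (simp add: add_mono)
  moreover have "rejection n \<mu> s \<le> ereal (U (mean_bound + (s - c + real n * mean_bound)))"
    using Suc by (intro rejection_le_of_value_le)
  moreover have "U (mean_bound + (s - c + real n * mean_bound))
      \<le> U (max x 0 + (s + real (Suc n) * mean_bound))"
    using strict_mono_less_eq[OF U(1)] c_pos by (simp add: algebra_simps)
  ultimately show ?case by (auto intro: order_trans)
qed

lemma rejection_bounded:
  assumes "\<mu> \<in> priors \<Theta>"
  shows "\<exists>z. rejection n \<mu> s \<le> ereal (U z)"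
  using rejection_le_of_value_le[OF assms value_fun_le] by blast

text \<open>
  Since the current offer can be accepted, the value is never \<open>-\<infinity>\<close>; it is thus the utility of
  some amount received on top of \<open>s\<close>.
\<close>
lemma value_fun_eq_utility:
  assumes "\<mu> \<in> priors \<Theta>"
  shows "\<exists>y. V n x \<mu> s = ereal (U (s + y))"
proof -
  have "ereal (U (x + s)) \<le> V n x \<mu> s" by (cases n) auto
  with value_fun_le[OF assms, of n x s] obtain r
    where r: "V n x \<mu> s = ereal r" "r \<le> U (max x 0 + (s + real n * mean_bound))"
    by (cases "V n x \<mu> s") auto
  then obtain w where "r = U w"
    using concave_strict_mono_attains_smaller[OF U(2,1)] by blast
  with r show ?thesis by (intro exI[of _ "w - s"]) simp
qed

section \<open>More stages increase the value of rejection\<close>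

lemma value_fun_mono_Suc: "V n x \<mu> s \<le> V (Suc n) x \<mu> s"
proof (induction n arbitrary: x \<mu> s)
  case (Suc n)
  then have "rejection n \<mu> s \<le> rejection (Suc n) \<mu> s"
    unfolding reject_value_def by (intro ereal_integral_mono)
  then show ?case unfolding value_fun.simps by (intro max.mono order_refl)
qed simp

lemma rejection_mono:
  assumes "m \<le> n"
  shows "rejection m \<mu> s \<le> rejection n \<mu> s"
proof -
  have "V m x \<mu>' s' \<le> V n x \<mu>' s'" for x \<mu>' s'
    using assms by (rule lift_Suc_mono_le[of "\<lambda>n. V n x \<mu>' s'", OF value_fun_mono_Suc])
  then show ?thesis unfolding reject_value_def by (intro ereal_integral_mono)
qed

section \<open>More wealth increases certainty equivalents\<close>

text \<open>
  If, at the next stage, the certainty equivalent relative to wealth increases with wealth, then so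
  does that of rejecting now. The statements compare upper bounds instead of inverting \<open>U\<close>,
  which also covers values \<open>-\<infinity>\<close>. The tangent inequality is taken at \<open>t + c\<close>, as wealth at
  the next stage is reduced by the cost \<open>c\<close>: it bounds the next value at the lower wealth by an
  affine function of the next value at the higher wealth, and this is integrated over the offer.
\<close>
lemma rejection_certainty_equivalent_step:
  assumes D: "DARA U" and s: "s \<le> s'" and mu: "\<mu> \<in> priors \<Theta>"
    and le: "rejection n \<mu> s' \<le> ereal (U (s' + t))"
    and V: "\<And>x \<mu> y. \<mu> \<in> priors \<Theta> \<Longrightarrow> V n x \<mu> (s' - c) \<le> ereal (U (s' - c + y))
      \<Longrightarrow> V n x \<mu> (s - c) \<le> ereal (U (s - c + y))"
  shows "rejection n \<mu> s \<le> ereal (U (s + t))"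
proof -
  let ?Q = "predictive lam q \<mu>"
  interpret prob_space ?Q by (rule predictive[OF mu])
  define b where "b = deriv U (s - c + (t + c)) / deriv U (s' - c + (t + c))"
  have b: "b > 0" using D by (simp add: b_def DARA_def)
  define f where "f x = real_of_ereal (V n x (posterior q \<nu> x \<mu>) (s' - c))" for x
  have f_eq: "V n x (posterior q \<nu> x \<mu>) (s' - c) = ereal (f x)" for x
    using value_fun_eq_utility[OF posterior_in_priors[OF mu]]
    unfolding f_def by (metis real_of_ereal.simps(1))
  have f_int: "ereal_integral ?Q (\<lambda>x. ereal (f x)) = rejection n \<mu> s'"
    by (simp add: reject_value_def f_eq)
  have f_meas: "f \<in> borel_measurable ?Q"
    using value_after_offer_measurable[OF mu] unfolding f_def
    by (auto simp: predictive(2)[OF mu] cong: measurable_cong_sets)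
  have ptwise: "V n x (posterior q \<nu> x \<mu>) (s - c)
      \<le> ereal ((U (s + t) - b * U (s' + t)) + b * f x)" for x
  proof -
    obtain y where y: "f x = U (s' - c + y)"
      using value_fun_eq_utility[OF posterior_in_priors[OF mu]] f_eq
      by (metis ereal.inject)
    have "V n x (posterior q \<nu> x \<mu>) (s - c) \<le> ereal (U (s - c + y))"
      using V[OF posterior_in_priors[OF mu]] f_eq y by simp
    also have "U (s - c + y) \<le> U (s + t) + b * (U (s' - c + y) - U (s' + t))"
      using DARA_wealth_comparison[OF D, of "s - c" "s' - c" y "t + c"] s by (simp add: b_def)
    finally show ?thesis by (simp add: y algebra_simps)
  qed
  have "rejection n \<mu> s
      \<le> ereal_integral ?Q (\<lambda>x. ereal ((U (s + t) - b * U (s' + t)) + b * f x))"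
    unfolding reject_value_def by (intro ereal_integral_mono ptwise)
  also have "\<dots> = ereal (U (s + t) - b * U (s' + t)) + ereal b * rejection n \<mu> s'"
    using le by (subst ereal_integral_affine[OF f_meas b]) (auto simp: f_int)
  also have "\<dots> \<le> ereal (U (s + t) - b * U (s' + t)) + ereal b * ereal (U (s' + t))"
    using le b by (intro add_left_mono ereal_mult_left_mono) auto
  finally show ?thesis by simp
qed

text \<open>
  Accepting pays \<open>U(s + x)\<close>, whose certainty equivalent relative to wealth is \<open>x\<close> at every
  wealth; so only the rejection branch of the maximum matters in the induction.
\<close>
lemma value_certainty_equivalent_mono:
  assumes D: "DARA U" and s: "s \<le> s'" and mu: "\<mu> \<in> priors \<Theta>"
    and le: "V n x \<mu> s' \<le> ereal (U (s' + t))"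
  shows "V n x \<mu> s \<le> ereal (U (s + t))"
  using s mu le
proof (induction n arbitrary: x \<mu> s s' t)
  case 0
  then show ?case using strict_mono_less_eq[OF U(1)] by simp
next
  case (Suc n)
  then have le: "U (x + s') \<le> U (s' + t)" "rejection n \<mu> s' \<le> ereal (U (s' + t))" by auto
  have "rejection n \<mu> s \<le> ereal (U (s + t))"
    by (rule rejection_certainty_equivalent_step[OF D Suc.prems(1,2) le(2)])
       (rule Suc.IH[of "s - c" "s' - c"], use Suc.prems(1) in auto)
  moreover have "U (x + s) \<le> U (s + t)"
    using le(1) strict_mono_less_eq[OF U(1)] by simp
  ultimately show ?case by simp
qed

lemma rejection_certainty_equivalent_mono:
  assumes D: "DARA U" and s: "s \<le> s'" and mu: "\<mu> \<in> priors \<Theta>"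
    and le: "rejection n \<mu> s' \<le> ereal (U (s' + t))"
  shows "rejection n \<mu> s \<le> ereal (U (s + t))"
  by (rule rejection_certainty_equivalent_step[OF D s mu le])
     (rule value_certainty_equivalent_mono[OF D, of "s - c" "s' - c"], use s in auto)

section \<open>Reservation levels\<close>

text \<open>
  The reservation level at time \<open>n\<close> includes the costs \<open>nc\<close> already paid, hence \<open>t - nc\<close> on the
  right. The index \<open>N - n - 1\<close> appears because \<open>c\<^sub>k\<close> integrates \<open>V\<^bsub>k-1\<^esub>\<close>.
\<close>
lemma reservation_level_le_iff:
  assumes "\<mu> \<in> priors \<Theta>"
  shows "reservation_level lam q c U \<nu> n N \<mu> \<le> ereal t
    \<longleftrightarrow> rejection (N - n - 1) \<mu> (- (real n * c)) \<le> ereal (U (t - real n * c))"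
proof -
  let ?y = "rejection (N - n - 1) \<mu> (- (real n * c))"
  obtain z where z: "?y \<le> ereal (U z)" using rejection_bounded[OF assms] by blast
  show ?thesis
  proof (cases ?y)
    case (real r)
    then obtain w where w: "r = U w"
      using z concave_strict_mono_attains_smaller[OF U(2,1), of r z] by auto
    have "inj (shifted_utility c U n)"
      using strict_mono_eq[OF U(1)] by (auto simp: inj_on_def shifted_utility_def)
    then have "inv (shifted_utility c U n) (U w) = w + real n * c"
      by (rule inv_f_eq) (simp add: shifted_utility_def)
    with real w show ?thesis
      using strict_mono_less_eq[OF U(1)]
      by (auto simp: reservation_level_def continuation_value_def ext_inv_def)
  next
    case PInf
    with z show ?thesis by simp
  next
    case MInf
    then show ?thesis
      by (simp add: reservation_level_def continuation_value_def ext_inv_def)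
  qed
qed

theorem reservation_level_mono_horizon:
  assumes "\<mu> \<in> priors \<Theta>" "N \<le> N'"
  shows "reservation_level lam q c U \<nu> n N \<mu> \<le> reservation_level lam q c U \<nu> n N' \<mu>"
proof (rule ereal_le_real)
  fix t assume "reservation_level lam q c U \<nu> n N' \<mu> \<le> ereal t"
  moreover have "rejection (N - n - 1) \<mu> (- (real n * c)) \<le> rejection (N' - n - 1) \<mu> (- (real n * c))"
    using assms(2) by (intro rejection_mono) simp
  ultimately show "reservation_level lam q c U \<nu> n N \<mu> \<le> ereal t"
    using assms(1) by (auto simp: reservation_level_le_iff)
qed

text \<open>
  The two effects of a later time are separated by an intermediate value of rejection: the horizon
  of time \<open>n'\<close> at the wealth of time \<open>n\<close>.
\<close>
theorem reservation_level_antimono_time: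
  assumes D: "DARA U" and mu: "\<mu> \<in> priors \<Theta>" and n: "n \<le> n'"
  shows "reservation_level lam q c U \<nu> n' N \<mu> \<le> reservation_level lam q c U \<nu> n N \<mu>"
proof (rule ereal_le_real)
  fix t assume "reservation_level lam q c U \<nu> n N \<mu> \<le> ereal t"
  moreover have "rejection (N - n' - 1) \<mu> (- (real n * c)) \<le> rejection (N - n - 1) \<mu> (- (real n * c))"
    using n by (intro rejection_mono) simp
  ultimately have "rejection (N - n' - 1) \<mu> (- (real n * c)) \<le> ereal (U (- (real n * c) + t))"
    using mu by (auto simp: reservation_level_le_iff add.commute)
  moreover have "- (real n' * c) \<le> - (real n * c)"
    using n c_pos by (simp add: mult_right_mono)
  ultimately have "rejection (N - n' - 1) \<mu> (- (real n' * c)) \<le> ereal (U (- (real n' * c) + t))"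
    using rejection_certainty_equivalent_mono[OF D _ mu] by blast
  then show "reservation_level lam q c U \<nu> n' N \<mu> \<le> ereal t"
    using mu by (simp add: reservation_level_le_iff add.commute)
qed

end

theorem theorem4p10:
  fixes \<Theta> :: "'a::polish_space set"
    and lam :: "real measure"
    and q :: "real \<Rightarrow> 'a \<Rightarrow> real"
    and c :: real
    and U :: "real \<Rightarrow> real"
    and \<nu> :: "'a measure"
  assumes "\<Theta> \<in> sets borel"
    and "\<nu> \<in> priors \<Theta>"
    and "sigma_finite_measure lam" and "sets lam = sets borel"
    and "(\<lambda>(x, \<theta>). q x \<theta>) \<in> borel_measurable (borel \<Otimes>\<^sub>M restrict_space borel \<Theta>)"
    and "\<And>x \<theta>. \<theta> \<in> \<Theta> \<Longrightarrow> 0 \<le> q x \<theta>"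
    and "\<And>\<theta>. \<theta> \<in> \<Theta> \<Longrightarrow> prob_space (offer_dist lam q \<theta>)"
    and "c > 0"
    and "strict_mono U" and "concave_on UNIV U"
    and "(SUP \<theta>\<in>\<Theta>. \<integral>\<^sup>+ x. ennreal (max x 0) \<partial>offer_dist lam q \<theta>) < \<infinity>"
  shows "(\<forall>\<mu>\<in>priors \<Theta>. \<forall>n. mono_on {n<..} (\<lambda>N. reservation_level lam q c U \<nu> n N \<mu>)) \<and>
         (DARA U \<longrightarrow>
            (\<forall>\<mu>\<in>priors \<Theta>. \<forall>N. antimono_on {..<N} (\<lambda>n. reservation_level lam q c U \<nu> n N \<mu>)))"
proof -
  interpret bayesian_house_selling \<Theta> lam q c U \<nu>
    using assms by (intro bayesian_house_selling.intro)
  show ?thesis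
    using reservation_level_mono_horizon reservation_level_antimono_time
    by (auto simp: monotone_on_def)
qed

end
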